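(* For a positive integer $n$ let $a(n)$ be the maximum of $|S|$ over all subsets $S\subseteq\{0,1,\dots,n-1\}^3$ such that no three distinct points of $S$ are collinear. Then for every prime $p$, $a(p)\ge p^2$.
   Context: Collinearity is in the usual sense of $\mathbb{R}^3$ (not modulo $p$): three distinct points are collinear if some straight line of $\mathbb{R}^3$ contains all three. *)

theory Defs
  imports "HOL-Analysis.Analysis" "HOL-Computational_Algebra.Primes"
begin

definition grid :: "nat \<Rightarrow> (real ^ 3) set" where
  "grid n = {x. \<forall>i. \<exists>k<n. x $ i = real k}"

definition no_three_collinear :: "(real ^ 3) set \<Rightarrow> bool" where
  "no_three_collinear S \<longleftrightarrow>
     (\<forall>x\<in>S. \<forall>y\<in>S. \<forall>z\<in>S. x \<noteq> y \<and> x \<noteq> z \<and> y \<noteq> z \<longrightarrow> \<not> collinear {x, y, z})"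

definition max_no_three_collinear :: "nat \<Rightarrow> nat" where
  "max_no_three_collinear n = Max {card S | S. S \<subseteq> grid n \<and> no_three_collinear S}"

text \<open>The maximum is taken over a finite nonempty set.\<close>

lemma finite_grid: "finite (grid n)"
proof -
  have "grid n \<subseteq> (\<lambda>f. \<chi> i. f i) ` (UNIV \<rightarrow>\<^sub>E real ` {..<n})"
  proof
    fix x assume "x \<in> grid n"
    then have "(\<lambda>i. x $ i) \<in> UNIV \<rightarrow>\<^sub>E real ` {..<n}"
      by (auto simp: grid_def)
    moreover have "x = (\<chi> i. x $ i)" by simp
    ultimately show "x \<in> (\<lambda>f. \<chi> i. f i) ` (UNIV \<rightarrow>\<^sub>E real ` {..<n})"
      by blast
  qed
  moreover have "finite ((UNIV :: 3 set) \<rightarrow>\<^sub>E real ` {..<n})"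
    by (intro finite_PiE) auto
  ultimately show ?thesis
    by (meson finite_surj)
qed

lemma max_no_three_collinear_candidates:
  "finite {card S | S. S \<subseteq> grid n \<and> no_three_collinear S}"
  "{card S | S. S \<subseteq> grid n \<and> no_three_collinear S} \<noteq> {}"
proof -
  show "finite {card S | S. S \<subseteq> grid n \<and> no_three_collinear S}"
    by (rule finite_subset[of _ "card ` Pow (grid n)"]) (auto simp: finite_grid)
  have "no_three_collinear {}" by (simp add: no_three_collinear_def)
  then show "{card S | S. S \<subseteq> grid n \<and> no_three_collinear S} \<noteq> {}" by blast
qed

end

theory Submission
  imports Defs "HOL-Number_Theory.Cong"
begin

text \<open>
  Take the paraboloid \<open>z \<equiv> Q(x, y) (mod p)\<close> over \<open>{0..<p}\<^sup>2\<close>, where \<open>Q\<close> is a binary quadratic form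
  without nontrivial zeros modulo \<open>p\<close>. Modulo \<open>p\<close>, the equation of the paraboloid restricts to a
  line with a polynomial of degree exactly two, so a line cannot meet the surface in three points
  that are distinct modulo \<open>p\<close>. The form \<open>x\<^sup>2 - x y - v y\<^sup>2\<close> is used instead of \<open>x\<^sup>2 - c y\<^sup>2\<close> because it
  also covers \<open>p = 2\<close>.
\<close>

definition qform :: "int \<Rightarrow> int \<Rightarrow> int \<Rightarrow> int" where
  "qform v x y = x\<^sup>2 - x * y - v * y\<^sup>2"

text \<open>The map \<open>t \<mapsto> t\<^sup>2 - t\<close> modulo \<open>p\<close> identifies 0 and 1, so it is not surjective.\<close>

lemma ex_not_dvd_square_minus_self_minus:
  fixes p :: int
  assumes "p > 1"
  obtains v where "\<And>t. \<not> p dvd t\<^sup>2 - t - v"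
proof -
  let ?f = "\<lambda>t. (t\<^sup>2 - t) mod p"
  have "?f ` {0..<p} \<noteq> {0..<p}"
  proof
    assume "?f ` {0..<p} = {0..<p}"
    then have "inj_on ?f {0..<p}"
      by (intro eq_card_imp_inj_on) auto
    then have "(0::int) = 1"
      by (rule inj_onD) (use assms in auto)
    then show False by simp
  qed
  moreover have "?f ` {0..<p} \<subseteq> {0..<p}"
    using assms by auto
  ultimately obtain v where v: "v \<in> {0..<p}" "v \<notin> ?f ` {0..<p}"
    by blast
  have "\<not> p dvd t\<^sup>2 - t - v" for t
  proof
    assume "p dvd t\<^sup>2 - t - v"
    then have "?f t = v"
      using v(1) by (simp add: mod_eq_dvd_iff[symmetric])
    moreover have "?f (t mod p) = ?f t"
      by (intro mod_diff_cong) (simp_all add: power_mod)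
    moreover have "?f (t mod p) \<in> ?f ` {0..<p}"
      using assms by (intro imageI) simp
    ultimately show False
      using v(2) by simp
  qed
  then show thesis by (rule that)
qed

text \<open>If \<open>y\<close> is invertible modulo \<open>p\<close>, dehomogenizing a zero with
  \<open>t = x / y\<close> gives a root of \<open>t\<^sup>2 - t - v\<close>, which the choice of
  \<open>v\<close> excludes.\<close>

lemma qform_anisotropic:
  fixes p :: int
  assumes "prime p" and v: "\<And>t. \<not> p dvd t\<^sup>2 - t - v" and dvd: "p dvd qform v x y"
  shows "p dvd x \<and> p dvd y"
proof (cases "p dvd y")
  case True
  then have "p dvd x * y + v * y\<^sup>2"
    by (simp add: power2_eq_square)
  with dvd have "p dvd qform v x y + (x * y + v * y\<^sup>2)"
    by (rule dvd_add)
  then have "p dvd x\<^sup>2"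
    by (simp add: qform_def)
  with True \<open>prime p\<close> show ?thesis
    by (meson prime_dvd_power)
next
  case False
  then have "coprime y p"
    using \<open>prime p\<close> by (simp add: prime_imp_coprime coprime_commute)
  then obtain k where "[y * k = 1] (mod p)"
    using cong_solve_coprime_int by blast
  then have k: "p dvd y * k - 1"
    by (simp add: cong_iff_dvd_diff)
  have "(x * k)\<^sup>2 - x * k - v
      = k\<^sup>2 * qform v x y + (y * k - 1) * (x * k + v * (y * k + 1))"
    by (simp add: qform_def power2_eq_square algebra_simps)
  then have "p dvd (x * k)\<^sup>2 - x * k - v"
    using dvd k by simp
  with v show ?thesis by blast
qed

lemma dvd_diff_residues_imp_eq:
  fixes p :: int
  assumes "p dvd a - b" "a \<in> {0..<p}" "b \<in> {0..<p}"
  shows "a = b"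
  using assms by (auto simp: mod_eq_dvd_iff[symmetric])

text \<open>Along a line with proportional steps \<open>u\<close> and \<open>w\<close>, this combination of the two increments of
  \<open>z - Q(x, y)\<close> eliminates the linear terms and leaves the leading coefficient \<open>Q(u)\<close>.\<close>

lemma qform_proportional_diff:
  assumes "t * u1 = s * w1" "t * u2 = s * w2" "t * u3 = s * w3"
  shows "t * (t - s) * qform v u1 u2
    = s * (t * (u3 - qform v u1 u2 - u1 * k + u2 * l) - s * (w3 - qform v w1 w2 - w1 * k + w2 * l))"
proof -
  \<comment> \<open>The form is homogeneous of degree two; the outer factor \<open>s\<close> in the
    claim produces the \<open>s\<^sup>2\<close> needed to trade \<open>Q(w)\<close> for
    \<open>Q(u)\<close>.\<close>
  have "t\<^sup>2 * qform v u1 u2 = qform v (t * u1) (t * u2)"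
    by (simp add: qform_def power2_eq_square algebra_simps)
  also have "\<dots> = s\<^sup>2 * qform v w1 w2"
    unfolding assms by (simp add: qform_def power2_eq_square algebra_simps)
  finally have "t * (t * qform v u1 u2) = s * (s * qform v w1 w2)"
    by (simp add: power2_eq_square mult.assoc)
  moreover have "s * (w3 - w1 * k + w2 * l) = t * u3 - t * u1 * k + t * u2 * l"
    unfolding assms by (simp add: algebra_simps)
  moreover have "s * (t * (u3 - qform v u1 u2 - u1 * k + u2 * l)
        - s * (w3 - qform v w1 w2 - w1 * k + w2 * l))
      = s * (t * u3 - t * u1 * k + t * u2 * l - s * (w3 - w1 * k + w2 * l))
        - s * t * qform v u1 u2 + s * (s * qform v w1 w2)"
    by (simp add: algebra_simps)
  ultimately show ?thesis
    by (simp only:) (simp add: algebra_simps)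
qed

lemma paraboloid_parallel_points:
  fixes p :: int
  assumes "prime p" and v: "\<And>t. \<not> p dvd t\<^sup>2 - t - v"
    and range: "a1 \<in> {0..<p}" "a2 \<in> {0..<p}" "b1 \<in> {0..<p}" "b2 \<in> {0..<p}"
      "c1 \<in> {0..<p}" "c2 \<in> {0..<p}"
    and surf: "p dvd a3 - qform v a1 a2" "p dvd b3 - qform v b1 b2" "p dvd c3 - qform v c1 c2"
    and par: "(b1 - a1) * (c2 - a2) = (b2 - a2) * (c1 - a1)"
      "(b1 - a1) * (c3 - a3) = (b3 - a3) * (c1 - a1)"
      "(b2 - a2) * (c3 - a3) = (b3 - a3) * (c2 - a2)"
    and ab: "(a1, a2) \<noteq> (b1, b2)" and ac: "(a1, a2) \<noteq> (c1, c2)"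
  shows "(b1, b2) = (c1, c2)"
proof -
  define q where "q = qform v (b1 - a1) (b2 - a2)"
  have q: "\<not> p dvd q"
  proof
    assume "p dvd q"
    then have "p dvd b1 - a1" "p dvd b2 - a2"
      using qform_anisotropic[OF \<open>prime p\<close> v] unfolding q_def by blast+
    then show False
      using ab range dvd_diff_residues_imp_eq by blast
  qed
  define f where "f = (\<lambda>x y z. z - qform v x y)"
  define F where "F = f b1 b2 b3 - f a1 a2 a3"
  define G where "G = f c1 c2 c3 - f a1 a2 a3"
  have FG: "p dvd F" "p dvd G"
    using surf unfolding F_def G_def f_def by (auto intro: dvd_diff)
  \<comment> \<open>Taylor expansion at \<open>a\<close>: the linear coefficients are the partial
    derivatives of the form there, hence the same in \<open>F\<close> and \<open>G\<close>.\<close>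
  have F: "F = (b3 - a3) - q - (b1 - a1) * (2 * a1 - a2) + (b2 - a2) * (a1 + 2 * v * a2)"
    and G: "G = (c3 - a3) - qform v (c1 - a1) (c2 - a2)
      - (c1 - a1) * (2 * a1 - a2) + (c2 - a2) * (a1 + 2 * v * a2)"
    by (simp_all add: F_def G_def f_def q_def qform_def power2_eq_square algebra_simps)
  \<comment> \<open>Each base coordinate in turn serves as the line's parameter, so no case split on
    which one varies is required.\<close>
  have eq1: "(c1 - a1) * ((c1 - a1) - (b1 - a1)) * q = (b1 - a1) * ((c1 - a1) * F - (b1 - a1) * G)"
    unfolding F G q_def by (rule qform_proportional_diff) (use par in \<open>simp_all add: mult.commute\<close>)
  have eq2: "(c2 - a2) * ((c2 - a2) - (b2 - a2)) * q = (b2 - a2) * ((c2 - a2) * F - (b2 - a2) * G)"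
    unfolding F G q_def by (rule qform_proportional_diff) (use par in \<open>simp_all add: mult.commute\<close>)
  have "p dvd (c1 - a1) * ((c1 - a1) - (b1 - a1)) * q" "p dvd (c2 - a2) * ((c2 - a2) - (b2 - a2)) * q"
    unfolding eq1 eq2 using FG by (auto intro: dvd_diff)
  then have "p dvd c1 - a1 \<or> p dvd c1 - b1" "p dvd c2 - a2 \<or> p dvd c2 - b2"
    using q \<open>prime p\<close> by (simp_all add: prime_dvd_mult_iff)
  then have "c1 = a1 \<or> c1 = b1" "c2 = a2 \<or> c2 = b2"
    using range dvd_diff_residues_imp_eq by blast+
  \<comment> \<open>In a mixed case such as \<open>c1 = a1\<close>, \<open>c2 = b2\<close>, the
    first minor forces \<open>b1 = a1\<close> or \<open>b2 = a2\<close>, so \<open>c\<close> agrees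
    with \<open>b\<close> or with \<open>a\<close>.\<close>
  with par(1) ab ac show ?thesis by auto
qed

text \<open>Both differences are multiples of one direction vector. The division-free form lets the
  equations descend from the reals to the integers.\<close>

lemma collinear_imp_parallel:
  fixes x y z :: "real ^ 'n"
  assumes "collinear {x, y, z}"
  shows "(y $ i - x $ i) * (z $ j - x $ j) = (y $ j - x $ j) * (z $ i - x $ i)"
proof -
  obtain u where u: "\<And>s t. s \<in> {x, y, z} \<Longrightarrow> t \<in> {x, y, z} \<Longrightarrow> \<exists>c. s - t = c *\<^sub>R u"
    using assms unfolding collinear_def by blast
  obtain c d where "y - x = c *\<^sub>R u" "z - x = d *\<^sub>R u"
    using u[of y x] u[of z x] by blast
  then have "y $ k - x $ k = c * u $ k" "z $ k - x $ k = d * u $ k" for k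
    by (metis vector_minus_component vector_scaleR_component real_scaleR_def)+
  then show ?thesis by simp
qed

theorem proposition3p1:
  fixes p :: nat
  assumes "prime p"
  shows "max_no_three_collinear p \<ge> p ^ 2"
proof -
  have p1: "int p > 1"
    using assms prime_gt_1_nat by simp
  obtain v where v: "\<And>t. \<not> int p dvd t\<^sup>2 - t - v"
    using ex_not_dvd_square_minus_self_minus[OF p1] by blast
  \<comment> \<open>Heights are least nonnegative residues, which keeps the points inside the
    grid.\<close>
  define h where "h = (\<lambda>(x, y). qform v x y mod int p)"
  define P :: "int \<times> int \<Rightarrow> real ^ 3"
    where "P = (\<lambda>(x, y). vector [of_int x, of_int y, of_int (h (x, y))])"
  define D where "D = {0..<int p} \<times> {0..<int p}"
  have P_simps: "P a $ 1 = of_int (fst a)" "P a $ 2 = of_int (snd a)" "P a $ 3 = of_int (h a)" for a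
    by (simp_all add: P_def case_prod_beta)
  have "inj_on P D"
    by (rule inj_onI) (metis P_simps(1,2) of_int_eq_iff prod_eqI)
  then have card: "card (P ` D) = p ^ 2"
    by (simp add: card_image D_def power2_eq_square)
  have "\<exists>k<p. real_of_int m = real k" if "0 \<le> m" "m < int p" for m
    using that by (intro exI[of _ "nat m"]) auto
  then have grid: "P ` D \<subseteq> grid p"
    using p1 by (auto simp: grid_def forall_3 P_simps D_def h_def)
  have "no_three_collinear (P ` D)"
    unfolding no_three_collinear_def
  proof (intro ballI impI notI)
    fix x y z
    assume "x \<in> P ` D" "y \<in> P ` D" "z \<in> P ` D" and distinct: "x \<noteq> y \<and> x \<noteq> z \<and> y \<noteq> z"
      and col: "collinear {x, y, z}"
    then obtain a b c where D: "a \<in> D" "b \<in> D" "c \<in> D" and xyz: "x = P a" "y = P b" "z = P c"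
      by blast
    have surf: "int p dvd h s - qform v (fst s) (snd s)" for s
      by (simp add: h_def case_prod_beta mod_eq_dvd_iff[symmetric])
    have par: "(fst b - fst a) * (snd c - snd a) = (snd b - snd a) * (fst c - fst a)"
      "(fst b - fst a) * (h c - h a) = (h b - h a) * (fst c - fst a)"
      "(snd b - snd a) * (h c - h a) = (h b - h a) * (snd c - snd a)"
      using collinear_imp_parallel[OF col, of 1 2] collinear_imp_parallel[OF col, of 1 3]
        collinear_imp_parallel[OF col, of 2 3]
      unfolding xyz P_simps of_int_diff[symmetric] of_int_mult[symmetric] of_int_eq_iff .
    \<comment> \<open>The surface is a graph over \<open>D\<close>, so distinct points have distinct
      base points.\<close>
    have "(fst b, snd b) = (fst c, snd c)"
    proof (rule paraboloid_parallel_points[OF _ v _ _ _ _ _ _ surf surf surf par])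
      show "prime (int p)" using assms by simp
    qed (use D distinct xyz in \<open>auto simp: D_def\<close>)
    with distinct xyz show False by simp
  qed
  with grid have "card (P ` D) \<in> {card S | S. S \<subseteq> grid p \<and> no_three_collinear S}"
    by blast
  then show ?thesis
    unfolding card max_no_three_collinear_def
    by (rule Max_ge[OF max_no_three_collinear_candidates(1)])
qed

end
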